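(* Let $K$ be a field and $A,M$ two $K$-vector spaces with two commuting linear maps $\alpha_A,\beta_A:A\to A$, two commuting linear maps $\alpha_M,\beta_M:M\to M$, and four linear maps $\mu_A:A\otimes A\to A$, $a\otimes b\mapsto ab$; $\mu_M:M\otimes M\to M$, $m\otimes n\mapsto mn$; $\triangleright:A\otimes M\to M$, $a\otimes m\mapsto a\triangleright m$; $\triangleleft:M\otimes A\to M$, $m\otimes a\mapsto m\triangleleft a$. Define a binary operation $\mu_{A\oplus M}$ on $A\oplus M$ by $$(a+m)(b+n)=ab+a\triangleright n+m\triangleleft b+mn,\qquad a,b\in A,\ m,n\in M.$$ Then $(A\oplus M,\mu_{A\oplus M},\alpha_A\oplus\alpha_M,\beta_A\oplus\beta_M)$ is a BiHom-associative algebra if and only if (a) $(A,\mu_A,\alpha_A,\beta_A)$ is a BiHom-associative algebra; and (b) $(M,\mu_M,\triangleright,\triangleleft,\alpha_M,\beta_M)$ is a BiHom-bimodule algebra over $(A,\mu_A,\alpha_A,\beta_A)$.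
   Context: $(f\oplus g)(a+m)=f(a)+g(m)$. BiHom-associative algebra $(A,\mu,\alpha,\beta)$: linear $\mu$ (written $ab$), $\alpha,\beta:A\to A$ with $\alpha\beta=\beta\alpha$, $\alpha(ab)=\alpha(a)\alpha(b)$, $\beta(ab)=\beta(a)\beta(b)$, $\alpha(a)(bc)=(ab)\beta(c)$. No unit is assumed. Bimodule $(M,\triangleright,\triangleleft,\alpha_M,\beta_M)$ over it: $\alpha_M\beta_M=\beta_M\alpha_M$; $f_M(a\triangleright m)=f_A(a)\triangleright f_M(m)$, $f_M(m\triangleleft a)=f_M(m)\triangleleft f_A(a)$ for $f\in\{\alpha,\beta\}$; $\alpha_A(a)\triangleright(a'\triangleright m)=(aa')\triangleright\beta_M(m)$; $\alpha_M(m)\triangleleft(aa')=(m\triangleleft a)\triangleleft\beta_A(a')$; $\alpha_A(a)\triangleright(m\triangleleft a')=(a\triangleright m)\triangleleft\beta_A(a')$. BiHom-bimodule algebra $(M,\mu_M,\triangleright,\triangleleft,\alpha_M,\beta_M)$: a bimodule such that $(M,\mu_M,\alpha_M,\beta_M)$ is a BiHom-associative algebra and $\alpha_A(a)\triangleright(mn)=(a\triangleright m)\beta_M(n)$, $\alpha_M(m)(n\triangleleft a)=(mn)\triangleleft\beta_A(a)$, $\alpha_M(m)(a\triangleright n)=(m\triangleleft a)\beta_M(n)$ for all $a\in A$, $m,n\in M$. *)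

theory Defs
  imports "HOL-Analysis.Product_Vector"
begin

text \<open>Linear maps out of a tensor product \<open>U \<otimes> V\<close> are represented by the corresponding
  bilinear maps on \<open>U\<close> and \<open>V\<close>.\<close>

definition bilinear_map ::
    "('k::field \<Rightarrow> 'u::ab_group_add \<Rightarrow> 'u) \<Rightarrow> ('k \<Rightarrow> 'v::ab_group_add \<Rightarrow> 'v) \<Rightarrow>
     ('k \<Rightarrow> 'w::ab_group_add \<Rightarrow> 'w) \<Rightarrow> ('u \<Rightarrow> 'v \<Rightarrow> 'w) \<Rightarrow> bool"
  where "bilinear_map sU sV sW f \<longleftrightarrow>
    (\<forall>u. Vector_Spaces.linear sV sW (\<lambda>v. f u v)) \<and>
    (\<forall>v. Vector_Spaces.linear sU sW (\<lambda>u. f u v))"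

locale bihom_assoc_algebra = vector_space scale
  for scale :: "'k::field \<Rightarrow> 'a::ab_group_add \<Rightarrow> 'a" +
  fixes mult :: "'a \<Rightarrow> 'a \<Rightarrow> 'a"
    and \<alpha> :: "'a \<Rightarrow> 'a"
    and \<beta> :: "'a \<Rightarrow> 'a"
  assumes bilinear_mult: "bilinear_map scale scale scale mult"
    and linear_alpha: "Vector_Spaces.linear scale scale \<alpha>"
    and linear_beta: "Vector_Spaces.linear scale scale \<beta>"
    and alpha_beta_commute: "\<alpha> \<circ> \<beta> = \<beta> \<circ> \<alpha>"
    and alpha_mult: "\<alpha> (mult a b) = mult (\<alpha> a) (\<alpha> b)"
    and beta_mult: "\<beta> (mult a b) = mult (\<beta> a) (\<beta> b)"
    and bihom_assoc: "mult (\<alpha> a) (mult b c) = mult (mult a b) (\<beta> c)"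

locale bihom_bimodule =
  A: bihom_assoc_algebra sA multA \<alpha>A \<beta>A + M: vector_space sM
  for sA :: "'k::field \<Rightarrow> 'a::ab_group_add \<Rightarrow> 'a"
    and multA :: "'a \<Rightarrow> 'a \<Rightarrow> 'a"
    and \<alpha>A :: "'a \<Rightarrow> 'a"
    and \<beta>A :: "'a \<Rightarrow> 'a"
    and sM :: "'k \<Rightarrow> 'm::ab_group_add \<Rightarrow> 'm" +
  fixes lact :: "'a \<Rightarrow> 'm \<Rightarrow> 'm"
    and ract :: "'m \<Rightarrow> 'a \<Rightarrow> 'm"
    and \<alpha>M :: "'m \<Rightarrow> 'm"
    and \<beta>M :: "'m \<Rightarrow> 'm"
  assumes bilinear_lact: "bilinear_map sA sM sM lact"
    and bilinear_ract: "bilinear_map sM sA sM ract"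
    and linear_alphaM: "Vector_Spaces.linear sM sM \<alpha>M"
    and linear_betaM: "Vector_Spaces.linear sM sM \<beta>M"
    and alphaM_betaM_commute: "\<alpha>M \<circ> \<beta>M = \<beta>M \<circ> \<alpha>M"
    and alphaM_lact: "\<alpha>M (lact a m) = lact (\<alpha>A a) (\<alpha>M m)"
    and betaM_lact: "\<beta>M (lact a m) = lact (\<beta>A a) (\<beta>M m)"
    and alphaM_ract: "\<alpha>M (ract m a) = ract (\<alpha>M m) (\<alpha>A a)"
    and betaM_ract: "\<beta>M (ract m a) = ract (\<beta>M m) (\<beta>A a)"
    and lact_lact: "lact (\<alpha>A a) (lact a' m) = lact (multA a a') (\<beta>M m)"
    and ract_ract: "ract (\<alpha>M m) (multA a a') = ract (ract m a) (\<beta>A a')"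
    and lact_ract: "lact (\<alpha>A a) (ract m a') = ract (lact a m) (\<beta>A a')"

locale bihom_bimodule_algebra =
  bihom_bimodule sA multA \<alpha>A \<beta>A sM lact ract \<alpha>M \<beta>M +
  M: bihom_assoc_algebra sM multM \<alpha>M \<beta>M
  for sA :: "'k::field \<Rightarrow> 'a::ab_group_add \<Rightarrow> 'a"
    and multA :: "'a \<Rightarrow> 'a \<Rightarrow> 'a"
    and \<alpha>A :: "'a \<Rightarrow> 'a"
    and \<beta>A :: "'a \<Rightarrow> 'a"
    and sM :: "'k \<Rightarrow> 'm::ab_group_add \<Rightarrow> 'm"
    and multM :: "'m \<Rightarrow> 'm \<Rightarrow> 'm"
    and lact :: "'a \<Rightarrow> 'm \<Rightarrow> 'm"
    and ract :: "'m \<Rightarrow> 'a \<Rightarrow> 'm"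
    and \<alpha>M :: "'m \<Rightarrow> 'm"
    and \<beta>M :: "'m \<Rightarrow> 'm" +
  assumes lact_multM: "lact (\<alpha>A a) (multM m n) = multM (lact a m) (\<beta>M n)"
    and multM_ract: "multM (\<alpha>M m) (ract n a) = ract (multM m n) (\<beta>A a)"
    and multM_lact: "multM (\<alpha>M m) (lact a n) = multM (ract m a) (\<beta>M n)"

text \<open>The direct sum \<open>A \<oplus> M\<close> is the product type, with \<open>a + m\<close> written as the pair
  \<open>(a, m)\<close>, scalar multiplication \<^const>\<open>module_prod.scale\<close> and \<open>f \<oplus> g\<close> given by
  \<^const>\<open>map_prod\<close>.\<close>

definition direct_sum_mult ::
    "('a \<Rightarrow> 'a \<Rightarrow> 'a) \<Rightarrow> ('m::ab_group_add \<Rightarrow> 'm \<Rightarrow> 'm) \<Rightarrow> ('a \<Rightarrow> 'm \<Rightarrow> 'm) \<Rightarrow>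
     ('m \<Rightarrow> 'a \<Rightarrow> 'm) \<Rightarrow> 'a \<times> 'm \<Rightarrow> 'a \<times> 'm \<Rightarrow> 'a \<times> 'm"
  where "direct_sum_mult multA multM lact ract =
    (\<lambda>(a, m) (b, n). (multA a b, lact a n + ract m b + multM m n))"

end

theory Submission
  imports Defs
begin

text \<open>All structure maps being additive, an identity between maps that are multilinear in
  elements of \<open>A \<oplus> M\<close> holds iff it holds when each argument is taken from \<open>A\<close> or from \<open>M\<close>.
  For the three BiHom axioms of \<open>A \<oplus> M\<close>, these pure cases are exactly the axioms of \<open>A\<close>, the
  bimodule axioms of \<open>M\<close>, the axioms of \<open>M\<close> as an algebra and the three compatibility
  conditions.\<close>

text \<open>The equation for \<open>module_prod.scale\<close> comes from a locale and so carries
  hypotheses; here they are discharged from the two vector-space assumptions.\<close>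

lemma module_prod_scale_apply:
  assumes "vector_space sA" "vector_space sM"
  shows "module_prod.scale sA sM c (a, m) = (sA c a, sM c m)"
  using assms by (simp add: module_prod.scale_prod module_prod_def module_pair_def
      module_iff_vector_space)

lemma vector_space_module_prod_scale:
  assumes "vector_space sA" "vector_space sM"
  shows "vector_space (module_prod.scale sA sM)"
proof -
  interpret vector_space_prod sA sM
    using assms by (simp add: vector_space_prod_def vector_space_pair_def)
  show ?thesis ..
qed

lemma linear_map_prod:
  assumes "Vector_Spaces.linear sA sA f" "Vector_Spaces.linear sM sM g"
  shows "Vector_Spaces.linear (module_prod.scale sA sM) (module_prod.scale sA sM) (map_prod f g)"
  using assms
  by (auto simp: Vector_Spaces.linear_iff module_prod_scale_apply vector_space_module_prod_scale)

text \<open>Turns bilinearity into equations usable as rewrite rules; the vector-space conjuncts are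
  those contained in \<open>Vector_Spaces.linear\<close>.\<close>

lemma bilinear_map_iff:
  fixes sU :: "'k::field \<Rightarrow> 'u::ab_group_add \<Rightarrow> 'u"
    and sV :: "'k \<Rightarrow> 'v::ab_group_add \<Rightarrow> 'v"
    and sW :: "'k \<Rightarrow> 'w::ab_group_add \<Rightarrow> 'w"
  shows "bilinear_map sU sV sW f \<longleftrightarrow> vector_space sU \<and> vector_space sV \<and> vector_space sW \<and>
    (\<forall>u x y. f u (x + y) = f u x + f u y) \<and> (\<forall>u c x. f u (sV c x) = sW c (f u x)) \<and>
    (\<forall>v x y. f (x + y) v = f x v + f y v) \<and> (\<forall>v c x. f (sU c x) v = sW c (f x v))"
  by (auto simp: bilinear_map_def Vector_Spaces.linear_iff)

lemma linear_zero:
  assumes "Vector_Spaces.linear s1 s2 f"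
  shows "f 0 = 0"
  using assms by (metis add_cancel_right_right Vector_Spaces.linear_iff)

lemma bilinear_map_zero:
  assumes "bilinear_map sU sV sW f"
  shows "f u 0 = 0" "f 0 v = 0"
  using assms linear_zero unfolding bilinear_map_def by blast+

text \<open>Each coordinate of the product is a sum of bilinear terms. The only law of scalars
  involved is distributivity over vector sums, \<open>vector_space_assms(1)\<close>.\<close>

lemma bilinear_direct_sum_mult:
  assumes "bilinear_map sA sA sA multA" "bilinear_map sM sM sM multM"
    and "bilinear_map sA sM sM lact" "bilinear_map sM sA sM ract"
  shows "bilinear_map (module_prod.scale sA sM) (module_prod.scale sA sM)
    (module_prod.scale sA sM) (direct_sum_mult multA multM lact ract)"
  using assms
  by (auto simp: bilinear_map_iff direct_sum_mult_def module_prod_scale_apply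
      vector_space_module_prod_scale vector_space.vector_space_assms(1) algebra_simps)

theorem lemma2p11:
  fixes sA :: "'k::field \<Rightarrow> 'a::ab_group_add \<Rightarrow> 'a"
    and sM :: "'k \<Rightarrow> 'm::ab_group_add \<Rightarrow> 'm"
    and \<alpha>A \<beta>A :: "'a \<Rightarrow> 'a"
    and \<alpha>M \<beta>M :: "'m \<Rightarrow> 'm"
    and multA :: "'a \<Rightarrow> 'a \<Rightarrow> 'a"
    and multM :: "'m \<Rightarrow> 'm \<Rightarrow> 'm"
    and lact :: "'a \<Rightarrow> 'm \<Rightarrow> 'm"
    and ract :: "'m \<Rightarrow> 'a \<Rightarrow> 'm"
  assumes "vector_space sA"
    and "vector_space sM"
    and "Vector_Spaces.linear sA sA \<alpha>A"
    and "Vector_Spaces.linear sA sA \<beta>A"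
    and "\<alpha>A \<circ> \<beta>A = \<beta>A \<circ> \<alpha>A"
    and "Vector_Spaces.linear sM sM \<alpha>M"
    and "Vector_Spaces.linear sM sM \<beta>M"
    and "\<alpha>M \<circ> \<beta>M = \<beta>M \<circ> \<alpha>M"
    and "bilinear_map sA sA sA multA"
    and "bilinear_map sM sM sM multM"
    and "bilinear_map sA sM sM lact"
    and "bilinear_map sM sA sM ract"
  shows "bihom_assoc_algebra (module_prod.scale sA sM) (direct_sum_mult multA multM lact ract)
           (map_prod \<alpha>A \<alpha>M) (map_prod \<beta>A \<beta>M)
     \<longleftrightarrow> bihom_assoc_algebra sA multA \<alpha>A \<beta>A
         \<and> bihom_bimodule_algebra sA multA \<alpha>A \<beta>A sM multM lact ract \<alpha>M \<beta>M"
  (is "bihom_assoc_algebra ?s ?mult ?\<alpha> ?\<beta> \<longleftrightarrow> ?A \<and> ?M")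
proof -
  have mult: "?mult (a, m) (b, n) = (multA a b, lact a n + ract m b + multM m n)" for a b m n
    by (simp add: direct_sum_mult_def)
  \<comment> \<open>With these, every term with a zero argument vanishes, so at pairs
    \<open>(_, 0)\<close> and \<open>(0, _)\<close> at most one term survives on each side of an
    axiom.\<close>
  note zero = assms(3,4,6,7)[THEN linear_zero] assms(9-12)[THEN bilinear_map_zero(1)]
    assms(9-12)[THEN bilinear_map_zero(2)]
  \<comment> \<open>Only maps with values in M, and only their arguments in M, are listed: the
    A-coordinate of a product is a single term, so sums arise in M alone.\<close>
  have add: "\<alpha>M (m + n) = \<alpha>M m + \<alpha>M n" "\<beta>M (m + n) = \<beta>M m + \<beta>M n"
    "multM m (n + p) = multM m n + multM m p" "multM (m + n) p = multM m p + multM n p"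
    "lact a (m + n) = lact a m + lact a n" "ract (m + n) a = ract m a + ract n a" for m n p a
    using assms by (simp_all add: Vector_Spaces.linear_iff bilinear_map_iff)
  show ?thesis
  proof
    assume "bihom_assoc_algebra ?s ?mult ?\<alpha> ?\<beta>"
    then interpret S: bihom_assoc_algebra ?s ?mult ?\<alpha> ?\<beta> .
    note pure = mult zero
    \<comment> \<open>The underscores stand for arbitrary elements, so each instance is an axiom of
      the direct sum restricted to one choice of pure arguments.\<close>
    have A: ?A
      unfolding bihom_assoc_algebra_def bihom_assoc_algebra_axioms_def
      using assms S.alpha_mult[of "(_, 0)" "(_, 0)"] S.beta_mult[of "(_, 0)" "(_, 0)"]
        S.bihom_assoc[of "(_, 0)" "(_, 0)" "(_, 0)"]
      by (simp add: pure)
    moreover have "bihom_assoc_algebra sM multM \<alpha>M \<beta>M"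
      unfolding bihom_assoc_algebra_def bihom_assoc_algebra_axioms_def
      using assms S.alpha_mult[of "(0, _)" "(0, _)"] S.beta_mult[of "(0, _)" "(0, _)"]
        S.bihom_assoc[of "(0, _)" "(0, _)" "(0, _)"]
      by (simp add: pure)
    \<comment> \<open>One argument from M. In associativity, its position selects the law: last
      gives \<open>lact_lact\<close>, first \<open>ract_ract\<close>, middle
      \<open>lact_ract\<close>.\<close>
    moreover have "bihom_bimodule_axioms sA multA \<alpha>A \<beta>A sM lact ract \<alpha>M \<beta>M"
      unfolding bihom_bimodule_axioms_def
      using assms S.alpha_mult[of "(_, 0)" "(0, _)"] S.beta_mult[of "(_, 0)" "(0, _)"]
        S.alpha_mult[of "(0, _)" "(_, 0)"] S.beta_mult[of "(0, _)" "(_, 0)"]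
        S.bihom_assoc[of "(_, 0)" "(_, 0)" "(0, _)"] S.bihom_assoc[of "(0, _)" "(_, 0)" "(_, 0)"]
        S.bihom_assoc[of "(_, 0)" "(0, _)" "(_, 0)"]
      by (simp add: pure)
    \<comment> \<open>One argument from A: first gives \<open>lact_multM\<close>, last
      \<open>multM_ract\<close>, middle \<open>multM_lact\<close>.\<close>
    moreover have "bihom_bimodule_algebra_axioms \<alpha>A \<beta>A multM lact ract \<alpha>M \<beta>M"
      unfolding bihom_bimodule_algebra_axioms_def
      using S.bihom_assoc[of "(_, 0)" "(0, _)" "(0, _)"] S.bihom_assoc[of "(0, _)" "(0, _)" "(_, 0)"]
        S.bihom_assoc[of "(0, _)" "(_, 0)" "(0, _)"]
      by (simp add: pure)
    ultimately show "?A \<and> ?M"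
      using assms(2) by (simp add: bihom_bimodule_algebra_def bihom_bimodule_def)
  next
    assume "?A \<and> ?M"
    then interpret bihom_bimodule_algebra sA multA \<alpha>A \<beta>A sM multM lact ract \<alpha>M \<beta>M
      by simp
    show "bihom_assoc_algebra ?s ?mult ?\<alpha> ?\<beta>"
      unfolding bihom_assoc_algebra_def bihom_assoc_algebra_axioms_def
    proof (intro conjI allI)
      show "vector_space ?s" "bilinear_map ?s ?s ?s ?mult"
        "Vector_Spaces.linear ?s ?s ?\<alpha>" "Vector_Spaces.linear ?s ?s ?\<beta>"
        using assms
        by (simp_all add: vector_space_module_prod_scale bilinear_direct_sum_mult linear_map_prod)
      show "?\<alpha> \<circ> ?\<beta> = ?\<beta> \<circ> ?\<alpha>"
        using assms by (simp add: map_prod.comp)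
      fix x y z :: "'a \<times> 'm"
      obtain a m b n c p where [simp]: "x = (a, m)" "y = (b, n)" "z = (c, p)"
        by (metis surj_pair)
      show "?\<alpha> (?mult x y) = ?mult (?\<alpha> x) (?\<alpha> y)"
        by (simp add: mult add A.alpha_mult M.alpha_mult alphaM_lact alphaM_ract)
      show "?\<beta> (?mult x y) = ?mult (?\<beta> x) (?\<beta> y)"
        by (simp add: mult add A.beta_mult M.beta_mult betaM_lact betaM_ract)
      \<comment> \<open>In the M-coordinate both sides expand to seven terms, matched one by one by
        the three bimodule laws, the three compatibility laws and associativity in M;
        \<open>algebra_simps\<close> only has to reorder the sum.\<close>
      show "?mult (?\<alpha> x) (?mult y z) = ?mult (?mult x y) (?\<beta> z)"
        by (simp add: mult add A.bihom_assoc M.bihom_assoc lact_lact ract_ract lact_ract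
            lact_multM multM_ract multM_lact algebra_simps)
    qed
  qed
qed

end
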